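(* Let $\alpha\in(0,1)$, $\lambda>0$, $\mu\ge0$, $\Lambda>0$, $c>0$, $d>0$, and $D=[0,1]$. For any viscosity sub-solution $(H_1,\psi_1)\in\mathbb{R}\times C(D)$ and any viscosity super-solution $(H_2,\psi_2)\in\mathbb{R}\times C(D)$ (in the sense defined in the context) of the Hamilton--Jacobi--Bellman equation $$H+\chi_{\{x>0\}}\left[\mu x^{1-\alpha}\frac{\mathrm{d}\Phi(x)}{\mathrm{d}x}+\int_{(0,\infty)}\left\{\Phi(x)-\Phi(x-\min\{x,z\})\right\}\lambda z^{-(\alpha+1)}\mathrm{d}z\right]+\Lambda\left(\Phi(x)-\min_{\eta\in\Xi_2(x)}\left\{\Phi(x+\eta)+c\eta+d\chi_{\{\eta>0\}}\right\}\right)-\chi_{\{x=0\}}=0,\quad x\in D,$$ we have $H_1\le H_2$. In addition, if $(H_1,\psi_1)$ and $(H_2,\psi_2)$ are viscosity solutions, then $H_1=H_2$.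
   Context: $\chi_A$ is the indicator of a condition $A$. $\Xi_2(0)=\{0,1\}$ and $\Xi_2(x)=\{0\}$ for $x\in(0,1]$. Put $v(\mathrm{d}z)=\lambda z^{-(\alpha+1)}\mathrm{d}z$ on $(0,\infty)$ and $j(x,z)=\min\{x,z\}$ for $(x,z)\in D\times(0,+\infty)$. $B(x,\delta)$ is the open ball with center $x$ and radius $\delta$. Viscosity sub- and super-solutions. A pair $h\in\mathbb{R}$, $\psi\in C(D)$ is a viscosity sub-solution (resp. super-solution) if at each $\hat x\in D$, for any $0<\delta<1$ and any $\varphi\in C^2(D)$ such that $\psi-\varphi$ is maximized (resp. minimized) at $x=\hat x$ on $B(\hat x,\delta)\cap D$, the following holds: (i) if $\hat x=0$: $$h+\Lambda\left(\psi(0)-\min_{\eta\in\Xi_2(0)}\left\{\psi(\eta)+c\eta+d\chi_{\{\eta>0\}}\right\}\right)-1\le0\quad(\text{resp. }\ge0);$$ (ii) if $\hat x\in(0,1]$: $$h+\left(\mu+\frac{\lambda}{\alpha(1-\alpha)}\right)\hat x^{1-\alpha}\frac{\mathrm{d}\varphi(\hat x)}{\mathrm{d}x}+\int_{(0,\delta)}\left\{\varphi(\hat x)-\varphi(\hat x-j(\hat x,z))-j(\hat x,z)\frac{\mathrm{d}\varphi(\hat x)}{\mathrm{d}x}\right\}v(\mathrm{d}z)+\int_{(\delta,\infty)}\left\{\psi(\hat x)-\psi(\hat x-j(\hat x,z))-j(\hat x,z)\frac{\mathrm{d}\varphi(\hat x)}{\mathrm{d}x}\right\}v(\mathrm{d}z)\le0\quad(\text{resp.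 }\ge0).$$ A viscosity solution is a pair that is both a viscosity sub-solution and a viscosity super-solution.
   Formalization: Condition (i) at x=0 is required outright, not only when some C² test function touches ψ at 0; under the guarded reading the claim fails: for small h>0 the pairs (h, −(h/C)x^α), for a suitable constant C>0, would all be viscosity solutions. *)

theory Defs
  imports "HOL-Analysis.Analysis"
begin

abbreviation D :: "real set" where
  "D \<equiv> {0..1}"

text \<open>
  Functions on \<open>D\<close> are represented by functions on all of the reals; their values outside \<open>D\<close>
  never enter. \<open>C2_on_D\<close> is twice continuous differentiability up to the boundary, with one-sided
  derivatives at the endpoints, and \<open>d_dx\<close> is the corresponding first derivative.
\<close>

definition C2_on_D :: "(real \<Rightarrow> real) \<Rightarrow> bool" where
  "C2_on_D \<phi> \<longleftrightarrow> (\<exists>\<phi>' \<phi>''.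
     (\<forall>x\<in>D. (\<phi> has_real_derivative \<phi>' x) (at x within D)) \<and>
     (\<forall>x\<in>D. (\<phi>' has_real_derivative \<phi>'' x) (at x within D)) \<and>
     continuous_on D \<phi>'')"

definition d_dx :: "(real \<Rightarrow> real) \<Rightarrow> real \<Rightarrow> real" where
  "d_dx \<phi> x = vector_derivative \<phi> (at x within D)"

definition maximized_at :: "(real \<Rightarrow> real) \<Rightarrow> real \<Rightarrow> real set \<Rightarrow> bool" where
  "maximized_at f a S \<longleftrightarrow> a \<in> S \<and> (\<forall>x\<in>S. f x \<le> f a)"

definition minimized_at :: "(real \<Rightarrow> real) \<Rightarrow> real \<Rightarrow> real set \<Rightarrow> bool" where
  "minimized_at f a S \<longleftrightarrow> a \<in> S \<and> (\<forall>x\<in>S. f a \<le> f x)"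

definition Xi2 :: "real \<Rightarrow> real set" where
  "Xi2 x = (if x = 0 then {0, 1} else {0})"

definition jump :: "real \<Rightarrow> real \<Rightarrow> real" where
  "jump x z = min x z"

definition jump_measure :: "real \<Rightarrow> real \<Rightarrow> real measure" where
  "jump_measure \<alpha> lam =
     density lborel (\<lambda>z. ennreal (lam * z powr (- (\<alpha> + 1)) * indicator {0<..} z))"

definition boundary_term ::
  "real \<Rightarrow> real \<Rightarrow> real \<Rightarrow> real \<Rightarrow> (real \<Rightarrow> real) \<Rightarrow> real" where
  "boundary_term \<Lambda> c d h \<psi> =
     h + \<Lambda> * (\<psi> 0 - (MIN \<eta>\<in>Xi2 0. \<psi> \<eta> + c * \<eta> + d * of_bool (\<eta> > 0))) - 1"

text \<open>
  For \<open>0 < \<alpha> < 1\<close>, \<open>x \<in> {0<..1}\<close>, \<open>0 < \<delta> < 1\<close>, \<open>\<phi>\<close> in \<open>C\<^sup>2(D)\<close> and \<open>\<psi>\<close> in \<open>C(D)\<close>, both integrands below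
  are integrable (the first one is \<open>O(z\<^sup>2)\<close> at 0, the second one is bounded), so the convention
  that non-integrable functions have integral 0 plays no role. The coefficient
  \<open>lam / (\<alpha> * (1 - \<alpha>)) * x powr (1 - \<alpha>)\<close> is the integral of \<open>jump x\<close> over \<open>{0<..}\<close>.
\<close>

definition interior_term ::
  "real \<Rightarrow> real \<Rightarrow> real \<Rightarrow> real \<Rightarrow> (real \<Rightarrow> real) \<Rightarrow> (real \<Rightarrow> real) \<Rightarrow> real \<Rightarrow> real \<Rightarrow> real" where
  "interior_term \<alpha> lam \<mu> h \<psi> \<phi> \<delta> x =
     h + (\<mu> + lam / (\<alpha> * (1 - \<alpha>))) * x powr (1 - \<alpha>) * d_dx \<phi> x
     + (LINT z:{0<..<\<delta>}|jump_measure \<alpha> lam. \<phi> x - \<phi> (x - jump x z) - jump x z * d_dx \<phi> x)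
     + (LINT z:{\<delta><..}|jump_measure \<alpha> lam. \<psi> x - \<psi> (x - jump x z) - jump x z * d_dx \<phi> x)"

text \<open>
  The inequality at the boundary point \<open>x = 0\<close> involves neither \<open>\<phi>\<close> nor \<open>\<delta>\<close> and is required outright.
  Requiring it only if some \<open>\<phi>\<close> in \<open>C\<^sup>2(D)\<close> touches \<open>\<psi>\<close> at 0 would make it vacuous for functions with
  infinite slope there: for suitable \<open>C > 0\<close>, the pairs \<open>(h, \<lambda>x. - (h / C) * x powr \<alpha>)\<close> with \<open>h > 0\<close>
  satisfy the equation on \<open>{0<..1}\<close>, no \<open>\<phi>\<close> touches them from below at 0, and for all small \<open>h > 0\<close>
  they would be both sub- and super-solutions, so that comparison and uniqueness would fail.
\<close>

definition viscosity_subsolution ::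
  "real \<Rightarrow> real \<Rightarrow> real \<Rightarrow> real \<Rightarrow> real \<Rightarrow> real \<Rightarrow> real \<Rightarrow> (real \<Rightarrow> real) \<Rightarrow> bool" where
  "viscosity_subsolution \<alpha> lam \<mu> \<Lambda> c d h \<psi> \<longleftrightarrow>
     continuous_on D \<psi> \<and>
     (\<forall>x\<in>D.
        (x = 0 \<longrightarrow> boundary_term \<Lambda> c d h \<psi> \<le> 0) \<and>
        (x \<in> {0<..1} \<longrightarrow>
          (\<forall>\<delta> \<phi>. 0 < \<delta> \<and> \<delta> < 1 \<and> C2_on_D \<phi> \<and>
                 maximized_at (\<lambda>y. \<psi> y - \<phi> y) x (ball x \<delta> \<inter> D) \<longrightarrow>
             interior_term \<alpha> lam \<mu> h \<psi> \<phi> \<delta> x \<le> 0)))"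

definition viscosity_supersolution ::
  "real \<Rightarrow> real \<Rightarrow> real \<Rightarrow> real \<Rightarrow> real \<Rightarrow> real \<Rightarrow> real \<Rightarrow> (real \<Rightarrow> real) \<Rightarrow> bool" where
  "viscosity_supersolution \<alpha> lam \<mu> \<Lambda> c d h \<psi> \<longleftrightarrow>
     continuous_on D \<psi> \<and>
     (\<forall>x\<in>D.
        (x = 0 \<longrightarrow> boundary_term \<Lambda> c d h \<psi> \<ge> 0) \<and>
        (x \<in> {0<..1} \<longrightarrow>
          (\<forall>\<delta> \<phi>. 0 < \<delta> \<and> \<delta> < 1 \<and> C2_on_D \<phi> \<and>
                 minimized_at (\<lambda>y. \<psi> y - \<phi> y) x (ball x \<delta> \<inter> D) \<longrightarrow>
             interior_term \<alpha> lam \<mu> h \<psi> \<phi> \<delta> x \<ge> 0)))"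

definition viscosity_solution ::
  "real \<Rightarrow> real \<Rightarrow> real \<Rightarrow> real \<Rightarrow> real \<Rightarrow> real \<Rightarrow> real \<Rightarrow> (real \<Rightarrow> real) \<Rightarrow> bool" where
  "viscosity_solution \<alpha> lam \<mu> \<Lambda> c d h \<psi> \<longleftrightarrow>
     viscosity_subsolution \<alpha> lam \<mu> \<Lambda> c d h \<psi> \<and> viscosity_supersolution \<alpha> lam \<mu> \<Lambda> c d h \<psi>"

end

theory Submission
  imports Defs
begin

text \<open>
  The interior equation is linear and first order, so comparison on \<open>{0<..1}\<close> follows by doubling
  variables. Let \<open>(x, y)\<close> maximize \<open>\<psi>1 x - \<psi>2 y - k / 2 * (x - y)\<^sup>2\<close> with \<open>x, y > 0\<close>. Since
  \<open>x - min x z = max (x - z) 0\<close> is 1-Lipschitz in \<open>x\<close>, comparing with the jumped points shows that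
  the nonlocal terms differ by something nonnegative, and the drift terms differ by
  \<open>\<mu> * k * (x - y) * (x powr (1 - \<alpha>) - y powr (1 - \<alpha>)) \<ge> 0\<close>. What is left is \<open>H1 - H2 \<le> O(\<delta> powr (2 - \<alpha>))\<close>.

  If \<open>\<psi>1 1 - \<psi>2 1 > \<psi>1 0 - \<psi>2 0\<close>, then for large \<open>k\<close> the maximizer avoids 0 and the above applies.
  Otherwise the two boundary inequalities at 0 give \<open>H1 \<le> H2\<close> directly, as the boundary term is
  monotone in \<open>\<psi> 0 - \<psi> 1\<close>.
\<close>

lemma sets_jump_measure [measurable_cong, simp]: "sets (jump_measure \<alpha> lam) = sets borel"
  by (simp add: jump_measure_def)

lemma space_jump_measure [simp]: "space (jump_measure \<alpha> lam) = UNIV"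
  by (simp add: jump_measure_def)

lemma has_bochner_integral_jump_measure:
  assumes lam: "0 \<le> lam"
    and A [measurable]: "A \<in> sets borel" and pos: "A \<subseteq> {0<..}"
    and g [measurable]: "g \<in> borel_measurable borel" and nonneg: "\<And>z. z \<in> A \<Longrightarrow> 0 \<le> g z"
    and int: "((\<lambda>z. z powr (- (\<alpha> + 1)) * g z) has_integral I) A"
  shows "has_bochner_integral (jump_measure \<alpha> lam) (\<lambda>z. indicator A z *\<^sub>R g z) (lam * I)"
proof (rule has_bochner_integral_nn_integral)
  let ?f = "\<lambda>z. if z \<in> A then lam * (z powr (- (\<alpha> + 1)) * g z) else 0"
  have int': "((\<lambda>z. lam * (z powr (- (\<alpha> + 1)) * g z)) has_integral (lam * I)) A"
    using int by (rule has_integral_mult_right)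
  have "0 \<le> I"
    using has_integral_nonneg[OF int] nonneg by simp
  then show "0 \<le> lam * I"
    using lam by simp
  have f: "(?f has_integral (lam * I)) A"
    by (rule has_integral_eq[OF _ int']) auto
  have "(\<integral>\<^sup>+z. ennreal (indicator A z *\<^sub>R g z) \<partial>jump_measure \<alpha> lam)
      = (\<integral>\<^sup>+z. ennreal (lam * z powr (- (\<alpha> + 1)) * indicator {0<..} z)
           * ennreal (indicator A z *\<^sub>R g z) \<partial>lborel)"
    unfolding jump_measure_def by (subst nn_integral_density) auto
  also have "\<dots> = (\<integral>\<^sup>+z. ennreal (indicator A z * ?f z) \<partial>lborel)"
    using pos lam nonneg
    by (intro nn_integral_cong) (auto simp: indicator_def ennreal_mult' [symmetric] mult_ac)
  also have "\<dots> = ennreal (lam * I)"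
    using nn_integral_has_integral_lebesgue[OF _ f] lam nonneg by simp
  finally show "(\<integral>\<^sup>+z. ennreal (indicator A z *\<^sub>R g z) \<partial>jump_measure \<alpha> lam) = ennreal (lam * I)" .
  show "AE z in jump_measure \<alpha> lam. 0 \<le> indicator A z *\<^sub>R g z"
    using nonneg by (auto simp: indicator_def)
qed simp_all

lemma has_integral_greaterThan_iff:
  fixes f :: "real \<Rightarrow> 'a :: banach"
  shows "(f has_integral y) {a<..} \<longleftrightarrow> (f has_integral y) {a..}"
proof -
  have "{a..} - {a<..} = {a}" by auto
  then show ?thesis
    using has_integral_interior[of "{a..}" f y] by (simp add: frontier_def interior_real_atLeast)
qed

lemma set_integrable_jump_measure_const:
  fixes \<alpha> lam \<delta> a :: real
  assumes "0 < \<alpha>" "0 \<le> lam" "0 < \<delta>"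
  shows "set_integrable (jump_measure \<alpha> lam) {\<delta><..} (\<lambda>z. a)"
proof -
  have "((\<lambda>z. z powr (- (\<alpha> + 1)) * 1) has_integral - (\<delta> powr (- (\<alpha> + 1) + 1)) / (- (\<alpha> + 1) + 1)) {\<delta><..}"
    using has_integral_powr_to_inf[of "- (\<alpha> + 1)" \<delta>] assms
    by (simp add: has_integral_greaterThan_iff)
  from has_bochner_integral_jump_measure[OF _ _ _ _ _ this] assms
  have "set_integrable (jump_measure \<alpha> lam) {\<delta><..} (\<lambda>z. 1 :: real)"
    by (auto simp: set_integrable_def has_bochner_integral_iff)
  then have "set_integrable (jump_measure \<alpha> lam) {\<delta><..} (\<lambda>z. a * 1)"
    by (rule set_integrable_mult_right)
  then show ?thesis by simp
qed

lemma set_integrable_jump_measure_bounded: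
  fixes \<alpha> lam \<delta> B :: real and f :: "real \<Rightarrow> real"
  assumes "0 < \<alpha>" "0 \<le> lam" "0 < \<delta>"
    and "continuous_on {\<delta><..} f" "\<And>z. z > \<delta> \<Longrightarrow> \<bar>f z\<bar> \<le> B"
  shows "set_integrable (jump_measure \<alpha> lam) {\<delta><..} f"
proof (rule set_integrable_bound[OF set_integrable_jump_measure_const[OF assms(1-3)]])
  have "set_borel_measurable borel {\<delta><..} f"
    using assms(4) by (intro borel_measurable_continuous_on_indicator[unfolded set_borel_measurable_def[symmetric]]) auto
  then show "set_borel_measurable (jump_measure \<alpha> lam) {\<delta><..} f"
    by (simp add: set_borel_measurable_def cong: measurable_cong_sets)
  show "AE z in jump_measure \<alpha> lam. z \<in> {\<delta><..} \<longrightarrow> norm (f z) \<le> norm B"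
    using assms(5) by force
qed

lemma large_jump_mean:
  fixes \<alpha> lam \<delta> x :: real
  assumes "0 < \<alpha>" "\<alpha> < 1" "0 \<le> lam" "0 < \<delta>" "\<delta> \<le> x"
  shows "(LINT z:{\<delta><..}|jump_measure \<alpha> lam. jump x z)
       = lam / (\<alpha> * (1 - \<alpha>)) * x powr (1 - \<alpha>) - lam / (1 - \<alpha>) * \<delta> powr (1 - \<alpha>)"
proof -
  let ?f = "\<lambda>z. z powr (- (\<alpha> + 1)) * jump x z"
  have "((\<lambda>z. z powr (- \<alpha>)) has_integral
      x powr (1 - \<alpha>) / (1 - \<alpha>) - \<delta> powr (1 - \<alpha>) / (1 - \<alpha>)) {\<delta>..x}"
    using assms
    by (intro fundamental_theorem_of_calculus)
       (auto intro!: derivative_eq_intros simp flip: has_real_derivative_iff_has_vector_derivative)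
  then have 1: "(?f has_integral x powr (1 - \<alpha>) / (1 - \<alpha>) - \<delta> powr (1 - \<alpha>) / (1 - \<alpha>)) {\<delta>..x}"
    by (rule has_integral_eq[rotated])
       (use assms in \<open>auto simp: jump_def powr_add [symmetric] powr_mult_base mult.commute[of _ "_::real"]\<close>)
  have "((\<lambda>z. x * z powr (- (\<alpha> + 1))) has_integral
       x * (- (x powr (- (\<alpha> + 1) + 1)) / (- (\<alpha> + 1) + 1))) {x..}"
    using assms by (intro has_integral_mult_right has_integral_powr_to_inf) auto
  also have "x * (- (x powr (- (\<alpha> + 1) + 1)) / (- (\<alpha> + 1) + 1)) = x powr (1 - \<alpha>) / \<alpha>"
    using assms powr_mult_base[of x "- \<alpha>"] by (simp add: field_simps)
  finally have 2: "(?f has_integral x powr (1 - \<alpha>) / \<alpha>) {x..}"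
    by (rule has_integral_eq[rotated]) (auto simp: jump_def)
  have "{\<delta>..x} \<inter> {x..} = {x}" "{\<delta>..x} \<union> {x..} = {\<delta>..}"
    using assms by auto
  then have "(?f has_integral (x powr (1 - \<alpha>) / (1 - \<alpha>) - \<delta> powr (1 - \<alpha>) / (1 - \<alpha>))
      + x powr (1 - \<alpha>) / \<alpha>) {\<delta>..}"
    using has_integral_Un[OF 1 2] by simp
  then have "(?f has_integral (x powr (1 - \<alpha>) / (1 - \<alpha>) - \<delta> powr (1 - \<alpha>) / (1 - \<alpha>))
      + x powr (1 - \<alpha>) / \<alpha>) {\<delta><..}"
    by (simp add: has_integral_greaterThan_iff)
  from has_bochner_integral_jump_measure[OF _ _ _ _ _ this, of lam] assms
  have "(LINT z:{\<delta><..}|jump_measure \<alpha> lam. jump x z) = lam * ((x powr (1 - \<alpha>) / (1 - \<alpha>) - \<delta> powr (1 - \<alpha>) / (1 - \<alpha>))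
      + x powr (1 - \<alpha>) / \<alpha>)"
    unfolding set_lebesgue_integral_def
    by (intro has_bochner_integral_integral_eq) (auto simp: jump_def)
  also have "\<dots> = lam / (\<alpha> * (1 - \<alpha>)) * x powr (1 - \<alpha>) - lam / (1 - \<alpha>) * \<delta> powr (1 - \<alpha>)"
    using assms by (simp add: divide_simps) (simp add: algebra_simps)
  finally show ?thesis .
qed

lemma small_jump_second_moment:
  fixes \<alpha> lam \<delta> x :: real
  assumes "\<alpha> < 2" "0 \<le> lam" "0 < \<delta>" "\<delta> \<le> x"
  shows "(LINT z:{0<..<\<delta>}|jump_measure \<alpha> lam. (jump x z)\<^sup>2) = lam / (2 - \<alpha>) * \<delta> powr (2 - \<alpha>)"
proof -
  have "((\<lambda>z. z powr (1 - \<alpha>)) has_integral \<delta> powr (1 - \<alpha> + 1) / (1 - \<alpha> + 1)) {0..\<delta>}"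
    using assms by (intro has_integral_powr_from_0) auto
  then have "((\<lambda>z. z powr (1 - \<alpha>)) has_integral \<delta> powr (1 - \<alpha> + 1) / (1 - \<alpha> + 1)) {0<..<\<delta>}"
    using has_integral_open_interval[of _ _ 0 \<delta>] unfolding box_real by blast
  then have "((\<lambda>z. z powr (- (\<alpha> + 1)) * (jump x z)\<^sup>2) has_integral
      \<delta> powr (1 - \<alpha> + 1) / (1 - \<alpha> + 1)) {0<..<\<delta>}"
    by (rule has_integral_eq[rotated])
       (use assms in \<open>auto simp: jump_def powr_add [symmetric] simp flip: powr_numeral\<close>)
  from has_bochner_integral_jump_measure[OF _ _ _ _ _ this, of lam] assms
  have "has_bochner_integral (jump_measure \<alpha> lam) (\<lambda>z. indicator {0<..<\<delta>} z *\<^sub>R (jump x z)\<^sup>2)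
      (lam * (\<delta> powr (1 - \<alpha> + 1) / (1 - \<alpha> + 1)))"
    by (auto simp: jump_def greaterThanLessThan_def)
  then show ?thesis
    unfolding set_lebesgue_integral_def
    by (simp add: has_bochner_integral_iff)
qed

lemma quadratic_has_derivative:
  "((\<lambda>t. k / 2 * (t - a)\<^sup>2) has_real_derivative k * (x - a)) (at x within S)" for k a x :: real
  by (auto intro!: derivative_eq_intros)

lemma C2_on_D_quadratic: "C2_on_D (\<lambda>t. k / 2 * (t - a)\<^sup>2)"
  unfolding C2_on_D_def
  by (rule exI[of _ "\<lambda>t. k * (t - a)"], rule exI[of _ "\<lambda>t. k"])
     (auto intro!: quadratic_has_derivative derivative_eq_intros)

lemma d_dx_quadratic:
  assumes "x \<in> D"
  shows "d_dx (\<lambda>t. k / 2 * (t - a)\<^sup>2) x = k * (x - a)"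
  unfolding d_dx_def using assms
  by (intro vector_derivative_within_closed_interval
        quadratic_has_derivative[unfolded has_real_derivative_iff_has_vector_derivative]) auto

lemma interior_term_quadratic:
  assumes "\<alpha> < 2" "0 \<le> lam" "0 < \<delta>" "\<delta> \<le> x" "x \<le> 1"
  shows "interior_term \<alpha> lam \<mu> h \<psi> (\<lambda>t. k / 2 * (t - a)\<^sup>2) \<delta> x =
     h + (\<mu> + lam / (\<alpha> * (1 - \<alpha>))) * x powr (1 - \<alpha>) * (k * (x - a))
     - k / 2 * (lam / (2 - \<alpha>) * \<delta> powr (2 - \<alpha>))
     + (LINT z:{\<delta><..}|jump_measure \<alpha> lam. \<psi> x - \<psi> (x - jump x z) - jump x z * (k * (x - a)))"
proof -
  have "k / 2 * (x - a)\<^sup>2 - k / 2 * (x - j - a)\<^sup>2 - j * (k * (x - a)) = - (k / 2) * j\<^sup>2" for j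
    by (simp add: power2_eq_square field_simps)
  moreover have "x \<in> D" using assms by auto
  ultimately show ?thesis
    unfolding interior_term_def
    using small_jump_second_moment[OF assms(1-4)]
    by (simp only: d_dx_quadratic set_integral_mult_right)
qed

lemma set_integrable_jump:
  assumes "0 < \<alpha>" "0 \<le> lam" "0 < \<delta>" "x \<in> D"
  shows "set_integrable (jump_measure \<alpha> lam) {\<delta><..} (jump x)"
  using assms
  by (intro set_integrable_jump_measure_bounded[where B = 1])
     (auto simp: jump_def intro!: continuous_intros)

lemma set_integrable_increment:
  assumes "0 < \<alpha>" "0 \<le> lam" "0 < \<delta>" "x \<in> D" "continuous_on D \<psi>"
  shows "set_integrable (jump_measure \<alpha> lam) {\<delta><..} (\<lambda>z. \<psi> x - \<psi> (x - jump x z) - jump x z * p)"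
proof -
  have "bounded (\<psi> ` D)"
    using assms(5) by (intro compact_imp_bounded compact_continuous_image) auto
  then obtain B where B: "\<And>t. t \<in> D \<Longrightarrow> \<bar>\<psi> t\<bar> \<le> B"
    unfolding bounded_iff real_norm_def by blast
  have D: "x - jump x z \<in> D" if "\<delta> < z" for z
    using that assms by (auto simp: jump_def)
  have "continuous_on {\<delta><..} (\<lambda>z. \<psi> (x - jump x z))"
    using D by (intro continuous_on_compose2[OF assms(5)]) (auto simp: jump_def intro!: continuous_intros)
  then have "set_integrable (jump_measure \<alpha> lam) {\<delta><..} (\<lambda>z. \<psi> (x - jump x z))"
    using assms B D by (intro set_integrable_jump_measure_bounded[where B = B]) auto
  then show ?thesis
    using assms
    by (intro set_integral_diff set_integrable_mult_left set_integrable_jump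
          set_integrable_jump_measure_const) auto
qed

lemma comparison_at_positive_maximizer:
  fixes \<alpha> lam \<mu> \<Lambda> c d k x y :: real
  assumes par: "0 < \<alpha>" "\<alpha> < 1" "0 < lam" "0 \<le> \<mu>" and "0 \<le> k"
    and sub: "viscosity_subsolution \<alpha> lam \<mu> \<Lambda> c d H1 \<psi>1"
    and super: "viscosity_supersolution \<alpha> lam \<mu> \<Lambda> c d H2 \<psi>2"
    and x: "0 < x" "x \<le> 1" and y: "0 < y" "y \<le> 1"
    and max: "\<And>s t. s \<in> D \<Longrightarrow> t \<in> D \<Longrightarrow>
      \<psi>1 s - \<psi>2 t - k / 2 * (s - t)\<^sup>2 \<le> \<psi>1 x - \<psi>2 y - k / 2 * (x - y)\<^sup>2"
  shows "H1 \<le> H2"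
proof -
  let ?M = "jump_measure \<alpha> lam" and ?p = "k * (x - y)"
  have cont: "continuous_on D \<psi>1" "continuous_on D \<psi>2"
    using sub super by (auto simp: viscosity_subsolution_def viscosity_supersolution_def)
  have bound: "H1 - H2 \<le> k * (lam / (2 - \<alpha>) * \<delta> powr (2 - \<alpha>))"
    if \<delta>: "0 < \<delta>" "\<delta> < min x y" for \<delta>
  proof -
    let ?I1 = "\<lambda>z. \<psi>1 x - \<psi>1 (x - jump x z) - jump x z * ?p"
    let ?I2 = "\<lambda>z. \<psi>2 y - \<psi>2 (y - jump y z) - jump y z * ?p"
    have "maximized_at (\<lambda>s. \<psi>1 s - k / 2 * (s - y)\<^sup>2) x (ball x \<delta> \<inter> D)"
      using max[of _ y] x y \<delta> by (auto simp: maximized_at_def)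
    then have "interior_term \<alpha> lam \<mu> H1 \<psi>1 (\<lambda>s. k / 2 * (s - y)\<^sup>2) \<delta> x \<le> 0"
      using sub x y \<delta> C2_on_D_quadratic[of k y] unfolding viscosity_subsolution_def by force
    then have 1: "H1 + (\<mu> + lam / (\<alpha> * (1 - \<alpha>))) * x powr (1 - \<alpha>) * ?p
        - k / 2 * (lam / (2 - \<alpha>) * \<delta> powr (2 - \<alpha>)) + (LINT z:{\<delta><..}|?M. ?I1 z) \<le> 0"
      using par x \<delta> by (subst (asm) interior_term_quadratic) auto
    have "\<psi>2 y - (- k) / 2 * (y - x)\<^sup>2 \<le> \<psi>2 t - (- k) / 2 * (t - x)\<^sup>2" if "t \<in> D" for t
      using max[of x t] x that by (simp add: power2_commute)
    then have "minimized_at (\<lambda>t. \<psi>2 t - (- k) / 2 * (t - x)\<^sup>2) y (ball y \<delta> \<inter> D)"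
      using y \<delta> by (simp add: minimized_at_def)
    then have "interior_term \<alpha> lam \<mu> H2 \<psi>2 (\<lambda>t. (- k) / 2 * (t - x)\<^sup>2) \<delta> y \<ge> 0"
      using super x y \<delta> C2_on_D_quadratic[of "- k" x] unfolding viscosity_supersolution_def by force
    moreover have "(- k) * (y - x) = ?p"
      by (simp add: algebra_simps)
    with interior_term_quadratic[of \<alpha> lam \<delta> y \<mu> H2 \<psi>2 "- k" x]
    have "interior_term \<alpha> lam \<mu> H2 \<psi>2 (\<lambda>t. (- k) / 2 * (t - x)\<^sup>2) \<delta> y
        = H2 + (\<mu> + lam / (\<alpha> * (1 - \<alpha>))) * y powr (1 - \<alpha>) * ?p
        - (- k) / 2 * (lam / (2 - \<alpha>) * \<delta> powr (2 - \<alpha>)) + (LINT z:{\<delta><..}|?M. ?I2 z)"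
      using par y \<delta> by (simp only:)
    ultimately have 2: "H2 + (\<mu> + lam / (\<alpha> * (1 - \<alpha>))) * y powr (1 - \<alpha>) * ?p
        + k / 2 * (lam / (2 - \<alpha>) * \<delta> powr (2 - \<alpha>)) + (LINT z:{\<delta><..}|?M. ?I2 z) \<ge> 0"
      by simp
    have int1: "set_integrable ?M {\<delta><..} ?I1" and int2: "set_integrable ?M {\<delta><..} ?I2"
      using par cont x y \<delta> by (auto intro!: set_integrable_increment)
    have intj: "set_integrable ?M {\<delta><..} (jump x)" "set_integrable ?M {\<delta><..} (jump y)"
      using par x y \<delta> by (auto intro!: set_integrable_jump)
    have "?p * (jump y z - jump x z) \<le> ?I1 z - ?I2 z" if "z > \<delta>" for z
    proof -
      have "\<bar>(x - jump x z) - (y - jump y z)\<bar> \<le> \<bar>x - y\<bar>"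
        by (auto simp: jump_def)
      then have "((x - jump x z) - (y - jump y z))\<^sup>2 \<le> (x - y)\<^sup>2"
        by (rule abs_le_square_iff[THEN iffD1])
      then have "k / 2 * ((x - jump x z) - (y - jump y z))\<^sup>2 \<le> k / 2 * (x - y)\<^sup>2"
        using \<open>0 \<le> k\<close> by (intro mult_left_mono) auto
      moreover have "x - jump x z \<in> D" "y - jump y z \<in> D"
        using that x y \<delta> by (auto simp: jump_def)
      note max[OF this]
      ultimately show ?thesis
        by (simp add: algebra_simps)
    qed
    then have "(LINT z:{\<delta><..}|?M. ?p * (jump y z - jump x z)) \<le> (LINT z:{\<delta><..}|?M. ?I1 z - ?I2 z)"
      using set_integral_diff(1)[OF int1 int2] set_integral_diff(1)[OF intj(2,1)]
      by (intro set_integral_mono set_integrable_mult_right) auto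
    also have "\<dots> = (LINT z:{\<delta><..}|?M. ?I1 z) - (LINT z:{\<delta><..}|?M. ?I2 z)"
      using int1 int2 by (rule set_integral_diff(2))
    also have "(LINT z:{\<delta><..}|?M. ?p * (jump y z - jump x z))
        = ?p * ((LINT z:{\<delta><..}|?M. jump y z) - (LINT z:{\<delta><..}|?M. jump x z))"
      using intj by (simp add: set_integral_diff(2))
    also have "\<dots> = - (lam / (\<alpha> * (1 - \<alpha>)) * (x powr (1 - \<alpha>) - y powr (1 - \<alpha>)) * ?p)"
      using par x y \<delta> by (simp add: large_jump_mean algebra_simps)
    finally have 3: "- (lam / (\<alpha> * (1 - \<alpha>)) * (x powr (1 - \<alpha>) - y powr (1 - \<alpha>)) * ?p)
        \<le> (LINT z:{\<delta><..}|?M. ?I1 z) - (LINT z:{\<delta><..}|?M. ?I2 z)" .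
    have "0 \<le> (x - y) * (x powr (1 - \<alpha>) - y powr (1 - \<alpha>))"
    proof (cases "x \<le> y")
      case True
      then show ?thesis using par x by (intro mult_nonpos_nonpos) (auto intro!: powr_mono2)
    next
      case False
      then show ?thesis using par y by (intro mult_nonneg_nonneg) (auto intro!: powr_mono2)
    qed
    then have 4: "0 \<le> \<mu> * k * ((x - y) * (x powr (1 - \<alpha>) - y powr (1 - \<alpha>)))"
      using par \<open>0 \<le> k\<close> by simp
    define C where "C = lam / (\<alpha> * (1 - \<alpha>))"
    define E where "E = lam / (2 - \<alpha>) * \<delta> powr (2 - \<alpha>)"
    show ?thesis
      using 1 2 3 4 unfolding C_def [symmetric] E_def [symmetric] by (simp add: algebra_simps)
  qed
  have "((\<lambda>\<delta>. k * (lam / (2 - \<alpha>) * \<delta> powr (2 - \<alpha>))) \<longlongrightarrow> k * (lam / (2 - \<alpha>) * 0 powr (2 - \<alpha>)))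
      (at_right 0)"
    using par
    by (intro tendsto_intros tendsto_powr2) (auto simp: eventually_at_filter)
  moreover have "eventually (\<lambda>\<delta>. H1 - H2 \<le> k * (lam / (2 - \<alpha>) * \<delta> powr (2 - \<alpha>))) (at_right 0)"
    using bound x y by (auto simp: eventually_at_right_field intro!: exI[of _ "min x y"])
  ultimately have "H1 - H2 \<le> k * (lam / (2 - \<alpha>) * 0 powr (2 - \<alpha>))"
    by (rule tendsto_lowerbound) simp
  then show ?thesis by simp
qed

lemma doubling_maximizer_positive:
  fixes f g :: "real \<Rightarrow> real"
  assumes f: "continuous_on D f" and g: "continuous_on D g" and less: "f 0 - g 0 < f 1 - g 1"
  obtains k x y where "0 < k" "0 < x" "x \<le> 1" "0 < y" "y \<le> 1"
    "\<And>s t. s \<in> D \<Longrightarrow> t \<in> D \<Longrightarrow> f s - g t - k / 2 * (s - t)\<^sup>2 \<le> f x - g y - k / 2 * (x - y)\<^sup>2"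
proof -
  define e where "e = (f 1 - g 1) - (f 0 - g 0)"
  have e: "e > 0" using less by (simp add: e_def)
  have "uniformly_continuous_on D f" "uniformly_continuous_on D g"
    using f g by (auto intro: compact_uniformly_continuous)
  then obtain r1 r2 where r: "r1 > 0" "r2 > 0"
    "\<And>s t. s \<in> D \<Longrightarrow> t \<in> D \<Longrightarrow> \<bar>s - t\<bar> < r1 \<Longrightarrow> \<bar>f s - f t\<bar> < e"
    "\<And>s t. s \<in> D \<Longrightarrow> t \<in> D \<Longrightarrow> \<bar>s - t\<bar> < r2 \<Longrightarrow> \<bar>g s - g t\<bar> < e"
    using e unfolding uniformly_continuous_on_def dist_real_def by metis
  define r where "r = min r1 r2"
  have "r > 0" using r by (simp add: r_def)
  have "bounded (f ` D)" "bounded (g ` D)"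
    using f g by (auto intro!: compact_imp_bounded compact_continuous_image)
  then obtain B C where B: "\<And>t. t \<in> D \<Longrightarrow> \<bar>f t\<bar> \<le> B" and C: "\<And>t. t \<in> D \<Longrightarrow> \<bar>g t\<bar> \<le> C"
    unfolding bounded_iff real_norm_def by blast
  have "0 \<le> B" "0 \<le> C" using B[of 0] C[of 0] by auto
  define k where "k = 4 * (B + C + 1) / r\<^sup>2"
  have "k > 0" using \<open>0 \<le> B\<close> \<open>0 \<le> C\<close> \<open>r > 0\<close> by (simp add: k_def)
  let ?F = "\<lambda>p. f (fst p) - g (snd p) - k / 2 * (fst p - snd p)\<^sup>2"
  have "continuous_on (D \<times> D) ?F"
    by (auto intro!: continuous_intros continuous_on_compose2[OF f] continuous_on_compose2[OF g])
  then have "\<exists>p\<in>D \<times> D. \<forall>q\<in>D \<times> D. ?F q \<le> ?F p"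
    by (intro continuous_attains_sup) (auto intro: compact_Times)
  then obtain x y where xy: "x \<in> D" "y \<in> D" and
    max: "\<And>s t. s \<in> D \<Longrightarrow> t \<in> D \<Longrightarrow> f s - g t - k / 2 * (s - t)\<^sup>2 \<le> f x - g y - k / 2 * (x - y)\<^sup>2"
    by auto
  have diag: "f 1 - g 1 \<le> f x - g y - k / 2 * (x - y)\<^sup>2"
    using max[of 1 1] by simp
  have "k / 2 * (x - y)\<^sup>2 < k / 2 * r\<^sup>2"
    using diag B[of 1] B[of x] C[of 1] C[of y] xy \<open>r > 0\<close> by (simp add: k_def)
  then have "\<bar>x - y\<bar> < r"
    using \<open>k > 0\<close> \<open>r > 0\<close> by (auto intro: power2_less_imp_less)
  then have close: "\<bar>f x - f y\<bar> < e" "\<bar>g x - g y\<bar> < e"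
    using r xy by (auto simp: r_def)
  have "0 \<le> k / 2 * (x - y)\<^sup>2" using \<open>k > 0\<close> by simp
  then have "x \<noteq> 0" "y \<noteq> 0"
    using diag close by (auto simp: e_def)
  with xy have "0 < x" "x \<le> 1" "0 < y" "y \<le> 1" by auto
  with \<open>k > 0\<close> max show thesis by (intro that)
qed

lemma boundary_term_eq:
  "boundary_term \<Lambda> c d h \<psi> = h + \<Lambda> * max 0 (\<psi> 0 - \<psi> 1 - c - d) - 1"
  by (auto simp: boundary_term_def Xi2_def min_def max_def)

lemma comparison_principle:
  fixes \<alpha> lam \<mu> \<Lambda> c d :: real
  assumes par: "0 < \<alpha>" "\<alpha> < 1" "0 < lam" "0 \<le> \<mu>" "0 \<le> \<Lambda>"
    and sub: "viscosity_subsolution \<alpha> lam \<mu> \<Lambda> c d H1 \<psi>1"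
    and super: "viscosity_supersolution \<alpha> lam \<mu> \<Lambda> c d H2 \<psi>2"
  shows "H1 \<le> H2"
proof (cases "\<psi>1 0 - \<psi>2 0 < \<psi>1 1 - \<psi>2 1")
  case True
  have "continuous_on D \<psi>1" "continuous_on D \<psi>2"
    using sub super by (auto simp: viscosity_subsolution_def viscosity_supersolution_def)
  from doubling_maximizer_positive[OF this True] show ?thesis
    using comparison_at_positive_maximizer[OF par(1-4) _ sub super] by (metis less_imp_le)
next
  case False
  then have "max 0 (\<psi>2 0 - \<psi>2 1 - c - d) \<le> max 0 (\<psi>1 0 - \<psi>1 1 - c - d)"
    by auto
  then have "\<Lambda> * max 0 (\<psi>2 0 - \<psi>2 1 - c - d) \<le> \<Lambda> * max 0 (\<psi>1 0 - \<psi>1 1 - c - d)"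
    using par by (intro mult_left_mono)
  moreover have "boundary_term \<Lambda> c d H1 \<psi>1 \<le> 0" "boundary_term \<Lambda> c d H2 \<psi>2 \<ge> 0"
    using sub super by (auto simp: viscosity_subsolution_def viscosity_supersolution_def)
  ultimately show ?thesis
    by (simp add: boundary_term_eq)
qed

theorem proposition3:
  fixes \<alpha> lam \<mu> \<Lambda> c d :: real
  assumes "0 < \<alpha>" "\<alpha> < 1" "0 < lam" "0 \<le> \<mu>" "0 < \<Lambda>" "0 < c" "0 < d"
  shows "(\<forall>H1 \<psi>1 H2 \<psi>2. viscosity_subsolution \<alpha> lam \<mu> \<Lambda> c d H1 \<psi>1 \<and>
            viscosity_supersolution \<alpha> lam \<mu> \<Lambda> c d H2 \<psi>2 \<longrightarrow> H1 \<le> H2) \<and>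
         (\<forall>H1 \<psi>1 H2 \<psi>2. viscosity_solution \<alpha> lam \<mu> \<Lambda> c d H1 \<psi>1 \<and>
            viscosity_solution \<alpha> lam \<mu> \<Lambda> c d H2 \<psi>2 \<longrightarrow> H1 = H2)"
  using comparison_principle[OF assms(1-4) less_imp_le[OF assms(5)]]
  by (meson order_antisym viscosity_solution_def)

end
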